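(* For all non-negative integers $k$ and $l$, there exists a number $S$ such that for any collection of (distinct) sets $\mathcal{H}$, $|\mathcal{H}|>S$ implies that at least one of the following three propositions holds: (1) The $(k+1)$-singleton matrix can be found in $\mathcal{H}$. (2) The $(l+1)$-cosingleton matrix can be found in $\mathcal{H}$. (3) The $\min(k+1,l+1)$-monotone matrix can be found in $\mathcal{H}$. Moreover, denoting by $S(k,l)$ the smallest non-negative integer $S$ with this property, we have $$S(k,l)=S(l,k)\leq \binom{R(k+1)+R(l+1)-2}{R(k+1)-1}.$$
   Context: A 0-1 matrix $N$ with $a$ rows and $b$ columns can be found in a collection of sets $\mathcal{H}$ if there are distinct sets $H_1,\dots,H_a\in\mathcal{H}$ and distinct elements $e_1,\dots,e_b\in\bigcup_{H\in\mathcal{H}}H$ such that $N_{\alpha,\beta}=1$ if and only if $e_\beta\in H_\alpha$. For an integer $n\ge 1$, the following matrices have $n+1$ rows and $n$ columns with entries in $\{0,1\}$: the $n$-singleton matrix $S^n$, with $S^n_{i,j}=1$ iff $i=j+1$; the $n$-cosingleton matrix $\bar S^n$, with $\bar S^n_{i,j}=0$ iff $i=j$; the $n$-monotone matrix $M^n$, with $M^n_{i,j}=1$ iff $i\ge j+1$. For a positive integer $r$, $R(r)$ denotes the Ramsey number: the smallest positive integer $n$ such that for every partition $(A_0,A_1)$ of the set $\binom{[n]}{2}$ of 2-element subsets of $[n]=\{1,\dots,n\}$ there is $A'\subseteq[n]$ with $|A'|\ge r$ and either $\binom{A'}{2}\subseteq A_0$ or $\binom{A'}{2}\subseteq A_1$.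 *)

theory Defs
  imports "HOL-Library.Ramsey" "Jordan_Normal_Form.Matrix"
begin

text \<open>
  A matrix is found in a collection of sets if it occurs as an incidence matrix of distinct members
  of the collection against distinct elements of its union.
\<close>

definition found_in :: "nat mat \<Rightarrow> 'a set set \<Rightarrow> bool" where
  "found_in N \<H> \<longleftrightarrow>
     (\<exists>(H :: nat \<Rightarrow> 'a set) (e :: nat \<Rightarrow> 'a).
        inj_on H {..<dim_row N} \<and> H ` {..<dim_row N} \<subseteq> \<H> \<and>
        inj_on e {..<dim_col N} \<and> e ` {..<dim_col N} \<subseteq> \<Union>\<H> \<and>
        (\<forall>\<alpha><dim_row N. \<forall>\<beta><dim_col N. N $$ (\<alpha>, \<beta>) = 1 \<longleftrightarrow> e \<beta> \<in> H \<alpha>))"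

text \<open>
  Matrix indices start at 0. The conditions below only compare a row index with a column index, so
  they read the same for indices starting at 1.
\<close>

definition singleton_mat :: "nat \<Rightarrow> nat mat" where
  "singleton_mat n = mat (n + 1) n (\<lambda>(i, j). if i = j + 1 then 1 else 0)"

definition cosingleton_mat :: "nat \<Rightarrow> nat mat" where
  "cosingleton_mat n = mat (n + 1) n (\<lambda>(i, j). if i = j then 0 else 1)"

definition monotone_mat :: "nat \<Rightarrow> nat mat" where
  "monotone_mat n = mat (n + 1) n (\<lambda>(i, j). if i \<ge> j + 1 then 1 else 0)"

text \<open>
  The two parts of a partition may be empty; otherwise the condition would hold vacuously
  for \<open>n \<le> 2\<close>.
\<close>

definition ramsey_num :: "nat \<Rightarrow> nat" where
  "ramsey_num r =
     (LEAST n. n > 0 \<and>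
        (\<forall>A\<^sub>0 A\<^sub>1. A\<^sub>0 \<union> A\<^sub>1 = nsets {1..n} 2 \<and> A\<^sub>0 \<inter> A\<^sub>1 = {} \<longrightarrow>
           (\<exists>A' \<subseteq> {1..n}. card A' \<ge> r \<and> (nsets A' 2 \<subseteq> A\<^sub>0 \<or> nsets A' 2 \<subseteq> A\<^sub>1))))"

text \<open>
  Infinite collections are included; they need a separate disjunct because \<^const>\<open>card\<close> maps
  them to 0. The type argument is the type of the elements of the member sets.
\<close>

definition unavoidable_above :: "'a itself \<Rightarrow> nat \<Rightarrow> nat \<Rightarrow> nat \<Rightarrow> bool" where
  "unavoidable_above _ k l S \<longleftrightarrow>
     (\<forall>\<H> :: 'a set set. infinite \<H> \<or> card \<H> > S \<longrightarrow>
        found_in (singleton_mat (k + 1)) \<H> \<or>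
        found_in (cosingleton_mat (l + 1)) \<H> \<or>
        found_in (monotone_mat (min (k + 1) (l + 1))) \<H>)"

text \<open>
  A definition cannot quantify over all element types, so the minimum is taken over collections of
  sets of natural numbers. If \<^term>\<open>unavoidable_above TYPE('a) k l (S_num k l)\<close> holds for every
  type \<open>'a\<close>, then \<open>S_num k l\<close> is the least number that works for all types at once: any
  such number works for \<^typ>\<open>nat\<close> in particular.
\<close>

definition S_num :: "nat \<Rightarrow> nat \<Rightarrow> nat" where
  "S_num k l = (LEAST S. unavoidable_above TYPE(nat) k l S)"

end

theory Submission
  imports Defs
begin

text \<open>
  Repeatedly split the collection by an element that separates two of its members. A binary tree
  with more than \<open>(a + b) choose a\<close> leaves has a branch that takes one side more than \<open>a\<close> times or
  the other side more than \<open>b\<close> times. A set left behind at each such split, together with a member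
  of the last part, yields a collection whose incidence matrix against the splitting elements is
  prescribed on and below the diagonal. Ramsey's theorem makes it constant above the diagonal, too,
  which gives the cosingleton or the monotone matrix. The sides are exchanged by complementation,
  which also gives the symmetry of \<^const>\<open>S_num\<close>.
\<close>

section \<open>Incidence patterns without distinctness conditions\<close>

definition incidence :: "nat \<Rightarrow> (nat \<Rightarrow> nat \<Rightarrow> bool) \<Rightarrow> 'a set set \<Rightarrow> bool" where
  "incidence n P F \<longleftrightarrow>
     (\<exists>H e. (\<forall>i\<le>n. H i \<in> F) \<and> (\<forall>i\<le>n. \<forall>j<n. e j \<in> H i \<longleftrightarrow> P i j))"

lemma incidenceI:
  assumes "\<And>i. i \<le> n \<Longrightarrow> H i \<in> F"
    and "\<And>i j. i \<le> n \<Longrightarrow> j < n \<Longrightarrow> e j \<in> H i \<longleftrightarrow> P i j"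
  shows "incidence n P F"
  unfolding incidence_def using assms by blast

lemma incidenceE:
  assumes "incidence n P F"
  obtains H e where "\<And>i. i \<le> n \<Longrightarrow> H i \<in> F"
    and "\<And>i j. i \<le> n \<Longrightarrow> j < n \<Longrightarrow> e j \<in> H i \<longleftrightarrow> P i j"
  using assms unfolding incidence_def by blast

text \<open>Equal sets would give equal rows and equal elements equal columns, so for a pattern with
  distinct rows and columns the injectivity of \<open>H\<close> and \<open>e\<close> is automatic. A
  1 in each column puts its element into the union. Later constructions therefore never have to
  check distinctness.\<close>

lemma found_in_mat_iff:
  fixes F :: "'a set set"
  assumes rows: "\<And>i i'. i < i' \<Longrightarrow> i' \<le> n \<Longrightarrow> \<exists>j<n. P i j \<noteq> P i' j"
    and cols: "\<And>j j'. j < j' \<Longrightarrow> j' < n \<Longrightarrow> \<exists>i\<le>n. P i j \<noteq> P i j'"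
    and nonzero: "\<And>j. j < n \<Longrightarrow> \<exists>i\<le>n. P i j"
  shows "found_in (mat (n + 1) n (\<lambda>(i, j). if P i j then 1 else 0)) F \<longleftrightarrow> incidence n P F"
    (is "found_in ?N F \<longleftrightarrow> _")
proof
  assume "found_in ?N F"
  then obtain H e where "H ` {..<n + 1} \<subseteq> F"
    "\<forall>i<n + 1. \<forall>j<n. ?N $$ (i, j) = 1 \<longleftrightarrow> e j \<in> H i"
    unfolding found_in_def by auto
  then show "incidence n P F"
    by (intro incidenceI[where H = H and e = e]) (auto simp: less_Suc_eq_le split: if_splits)
next
  assume "incidence n P F"
  then obtain H e where H: "\<And>i. i \<le> n \<Longrightarrow> H i \<in> F"
    and e: "\<And>i j. i \<le> n \<Longrightarrow> j < n \<Longrightarrow> e j \<in> H i \<longleftrightarrow> P i j"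
    by (rule incidenceE) blast
  have "inj_on H {..<n + 1}"
  proof (rule linorder_inj_onI)
    fix i i' assume "i < i'" "i \<in> {..<n + 1}" "i' \<in> {..<n + 1}"
    then show "H i \<noteq> H i'"
      using rows[of i i'] e[of i] e[of i'] by fastforce
  qed auto
  moreover have "inj_on e {..<n}"
  proof (rule linorder_inj_onI)
    fix j j' assume "j < j'" "j \<in> {..<n}" "j' \<in> {..<n}"
    then show "e j \<noteq> e j'"
      using cols[of j j'] e[of _ j] e[of _ j'] by fastforce
  qed auto
  moreover have "e ` {..<n} \<subseteq> \<Union>F"
    using nonzero H e by fastforce
  ultimately show "found_in ?N F"
    unfolding found_in_def using H e
    by (intro exI[of _ H] exI[of _ e]) (auto simp: less_Suc_eq_le)
qed

lemma found_in_singleton_iff: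
  "found_in (singleton_mat n) F \<longleftrightarrow> incidence n (\<lambda>i j. i = j + 1) F"
  unfolding singleton_mat_def
proof (rule found_in_mat_iff)
  fix i i' :: nat assume "i < i'" "i' \<le> n"
  \<comment> \<open>Row \<open>i'\<close> is not row 0, so it has a 1 in column
    \<open>i' - 1\<close>, where row \<open>i\<close> has a 0.\<close>
  then show "\<exists>j<n. (i = j + 1) \<noteq> (i' = j + 1)" by (intro exI[of _ "i' - 1"]) auto
next
  fix j j' :: nat assume "j < j'" "j' < n"
  then show "\<exists>i\<le>n. (i = j + 1) \<noteq> (i = j' + 1)" by (intro exI[of _ "j + 1"]) auto
qed auto

lemma found_in_cosingleton_iff:
  "found_in (cosingleton_mat n) F \<longleftrightarrow> incidence n (\<lambda>i j. i \<noteq> j) F"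
proof -
  have "cosingleton_mat n = mat (n + 1) n (\<lambda>(i, j). if i \<noteq> j then 1 else 0)"
    unfolding cosingleton_mat_def by (rule eq_matI) auto
  moreover have "found_in \<dots> F \<longleftrightarrow> incidence n (\<lambda>i j. i \<noteq> j) F"
  proof (rule found_in_mat_iff)
    fix i i' :: nat assume "i < i'" "i' \<le> n"
    then show "\<exists>j<n. (i \<noteq> j) \<noteq> (i' \<noteq> j)" by (intro exI[of _ i]) auto
  next
    fix j j' :: nat assume "j < j'" "j' < n"
    then show "\<exists>i\<le>n. (i \<noteq> j) \<noteq> (i \<noteq> j')" by (intro exI[of _ j]) auto
  qed auto
  ultimately show ?thesis by simp
qed

lemma found_in_monotone_iff:
  "found_in (monotone_mat n) F \<longleftrightarrow> incidence n (\<lambda>i j. i \<ge> j + 1) F"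
  unfolding monotone_mat_def
proof (rule found_in_mat_iff)
  fix i i' :: nat assume "i < i'" "i' \<le> n"
  then show "\<exists>j<n. (i \<ge> j + 1) \<noteq> (i' \<ge> j + 1)" by (intro exI[of _ i]) auto
next
  fix j j' :: nat assume "j < j'" "j' < n"
  then show "\<exists>i\<le>n. (i \<ge> j + 1) \<noteq> (i \<ge> j' + 1)" by (intro exI[of _ "j + 1"]) auto
qed auto

text \<open>The leading \<open>m + 1\<close> rows and \<open>m\<close> columns again form a monotone
  matrix. This brings the sizes \<open>k + 1\<close> and \<open>l + 1\<close> down to their
  minimum.\<close>

lemma found_in_monotone_le:
  assumes "found_in (monotone_mat n) F" "m \<le> n"
  shows "found_in (monotone_mat m) F"
  using assms(1) unfolding found_in_monotone_iff
proof (elim incidenceE)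
  fix H e assume "\<And>i. i \<le> n \<Longrightarrow> H i \<in> F"
    "\<And>i j. i \<le> n \<Longrightarrow> j < n \<Longrightarrow> e j \<in> H i \<longleftrightarrow> j + 1 \<le> i"
  with assms(2) show "incidence m (\<lambda>i j. j + 1 \<le> i) F"
    by (intro incidenceI[where H = H and e = e]) auto
qed

lemma found_in_mono: "found_in N F \<Longrightarrow> F \<subseteq> G \<Longrightarrow> found_in N G"
  unfolding found_in_def by (meson Union_mono order_trans)

section \<open>Complementation and symmetry\<close>

lemma incidence_uminus:
  assumes "incidence n P (uminus ` F)"
  shows "incidence n (\<lambda>i j. \<not> P i j) F"
proof -
  obtain H e where H: "\<And>i. i \<le> n \<Longrightarrow> H i \<in> uminus ` F"
    and e: "\<And>i j. i \<le> n \<Longrightarrow> j < n \<Longrightarrow> e j \<in> H i \<longleftrightarrow> P i j"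
    using assms by (rule incidenceE) blast
  show ?thesis
  proof (rule incidenceI[where e = e])
    show "- H i \<in> F" if "i \<le> n" for i using H[OF that] by auto
    show "e j \<in> - H i \<longleftrightarrow> \<not> P i j" if "i \<le> n" "j < n" for i j using e that by simp
  qed
qed

lemma incidence_reindex:
  assumes "incidence n P F"
    and "\<And>i. i \<le> n \<Longrightarrow> f i \<le> n" and "\<And>j. j < n \<Longrightarrow> g j < n"
    and "\<And>i j. i \<le> n \<Longrightarrow> j < n \<Longrightarrow> P (f i) (g j) \<longleftrightarrow> Q i j"
  shows "incidence n Q F"
proof -
  obtain H e where "\<And>i. i \<le> n \<Longrightarrow> H i \<in> F"
    "\<And>i j. i \<le> n \<Longrightarrow> j < n \<Longrightarrow> e j \<in> H i \<longleftrightarrow> P i j"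
    using assms(1) by (rule incidenceE) blast
  with assms(2-) show ?thesis
    by (intro incidenceI[where H = "H \<circ> f" and e = "e \<circ> g"]) auto
qed

text \<open>The complemented pattern is an identity matrix followed by a zero row. Moving that last
  row to the front gives the singleton pattern.\<close>

lemma found_in_cosingleton_uminus:
  assumes "found_in (cosingleton_mat n) (uminus ` F)"
  shows "found_in (singleton_mat n) F"
proof -
  have "incidence n (\<lambda>i j. \<not> i \<noteq> j) F"
    using assms unfolding found_in_cosingleton_iff by (rule incidence_uminus)
  then show ?thesis unfolding found_in_singleton_iff
    by (rule incidence_reindex[where f = "\<lambda>i. if i = 0 then n else i - 1" and g = "\<lambda>j. j"]) auto
qed

text \<open>Here the complemented pattern starts with its row of ones, so the cyclic shift of the
  rows goes the other way.\<close>

lemma found_in_singleton_uminus: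
  assumes "found_in (singleton_mat n) (uminus ` F)"
  shows "found_in (cosingleton_mat n) F"
proof -
  have "incidence n (\<lambda>i j. \<not> i = j + 1) F"
    using assms unfolding found_in_singleton_iff by (rule incidence_uminus)
  then show ?thesis unfolding found_in_cosingleton_iff
    by (rule incidence_reindex[where f = "\<lambda>i. if i = n then 0 else i + 1" and g = "\<lambda>j. j"]) auto
qed

text \<open>Complementing leaves ones exactly where \<open>i <= j\<close>; reversing the order of
  both rows and columns restores the monotone pattern.\<close>

lemma found_in_monotone_uminus:
  assumes "found_in (monotone_mat n) (uminus ` F)"
  shows "found_in (monotone_mat n) F"
proof -
  have "incidence n (\<lambda>i j. \<not> j + 1 \<le> i) F"
    using assms unfolding found_in_monotone_iff by (rule incidence_uminus)
  then show ?thesis unfolding found_in_monotone_iff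
    by (rule incidence_reindex[where f = "\<lambda>i. n - i" and g = "\<lambda>j. n - 1 - j"]) auto
qed

text \<open>Taking complements preserves the size of a collection and exchanges the first two
  alternatives, while the third is symmetric in \<open>k\<close> and \<open>l\<close>.\<close>

lemma unavoidable_above_commute:
  assumes "unavoidable_above TYPE('a) k l S"
  shows "unavoidable_above TYPE('a) l k S"
  unfolding unavoidable_above_def
proof (intro allI impI)
  fix F :: "'a set set" assume F: "infinite F \<or> card F > S"
  have "inj_on uminus F" by (simp add: inj_on_def)
  then have "infinite (uminus ` F) \<or> card (uminus ` F) > S"
    using F by (simp add: card_image finite_image_iff)
  then have "found_in (singleton_mat (k + 1)) (uminus ` F) \<or>
    found_in (cosingleton_mat (l + 1)) (uminus ` F) \<or>
    found_in (monotone_mat (min (k + 1) (l + 1))) (uminus ` F)"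
    using assms unfolding unavoidable_above_def by blast
  then show "found_in (singleton_mat (l + 1)) F \<or> found_in (cosingleton_mat (k + 1)) F \<or>
    found_in (monotone_mat (min (l + 1) (k + 1))) F"
    using found_in_singleton_uminus found_in_cosingleton_uminus found_in_monotone_uminus
    by (metis min.commute)
qed

section \<open>Independence of the element type\<close>

text \<open>Distinct traces come from distinct sets, and each element of a trace has a preimage in
  \<open>E\<close> with the same memberships, because \<open>f\<close> is injective there.\<close>

lemma found_in_trace:
  assumes "found_in N ((\<lambda>X. f ` (X \<inter> E)) ` F)" and f: "inj_on f E"
  shows "found_in N F"
proof -
  let ?t = "\<lambda>X. f ` (X \<inter> E)"
  obtain H e where H: "inj_on H {..<dim_row N}" "H ` {..<dim_row N} \<subseteq> ?t ` F"
    and e: "inj_on e {..<dim_col N}" "e ` {..<dim_col N} \<subseteq> \<Union>(?t ` F)"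
    and N: "\<forall>i<dim_row N. \<forall>j<dim_col N. N $$ (i, j) = 1 \<longleftrightarrow> e j \<in> H i"
    using assms(1) unfolding found_in_def by blast
  have "\<exists>X. X \<in> F \<and> H i = ?t X" if "i < dim_row N" for i using H(2) that by blast
  then obtain G where G: "\<And>i. i < dim_row N \<Longrightarrow> G i \<in> F \<and> H i = ?t (G i)" by metis
  have "\<exists>x. x \<in> \<Union>F \<inter> E \<and> e j = f x" if "j < dim_col N" for j using e(2) that by blast
  then obtain d where d: "\<And>j. j < dim_col N \<Longrightarrow> d j \<in> \<Union>F \<inter> E \<and> e j = f (d j)" by metis
  have "inj_on G {..<dim_row N}"
    using H(1) G by (auto simp: inj_on_def)
  moreover have "inj_on d {..<dim_col N}"
    using e(1) d by (auto simp: inj_on_def)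
  moreover have "d j \<in> G i \<longleftrightarrow> e j \<in> H i" if "i < dim_row N" "j < dim_col N" for i j
    using G[OF that(1)] d[OF that(2)] f by (auto dest: inj_onD)
  ultimately show ?thesis
    unfolding found_in_def using G d N by (intro exI[of _ G] exI[of _ d]) auto
qed

text \<open>One point of difference for each pair of members suffices, and there are finitely many
  pairs.\<close>

lemma finite_separating_set:
  assumes "finite F"
  obtains E where "finite E" "inj_on (\<lambda>X. X \<inter> E) F"
proof -
  have "\<exists>x. X \<noteq> Y \<longrightarrow> (x \<in> X \<longleftrightarrow> x \<notin> Y)" for X Y :: "'a set" by blast
  then obtain d where d: "\<And>X Y :: 'a set. X \<noteq> Y \<longrightarrow> (d X Y \<in> X \<longleftrightarrow> d X Y \<notin> Y)" by metis
  show thesis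
  proof
    show "finite ((\<lambda>(X, Y). d X Y) ` (F \<times> F))" using assms by simp
    show "inj_on (\<lambda>X. X \<inter> (\<lambda>(X, Y). d X Y) ` (F \<times> F)) F"
    proof (rule inj_onI, rule ccontr)
      fix X Y assume XY: "X \<in> F" "Y \<in> F" "X \<noteq> Y"
        "X \<inter> (\<lambda>(X, Y). d X Y) ` (F \<times> F) = Y \<inter> (\<lambda>(X, Y). d X Y) ` (F \<times> F)"
      have "d X Y \<in> (\<lambda>(X, Y). d X Y) ` (F \<times> F)" using XY by force
      then show False using d[of X Y] XY(3,4) by blast
    qed
  qed
qed

lemma obtain_finite_subset_card_gt:
  assumes "infinite F \<or> card F > S"
  obtains G where "G \<subseteq> F" "finite G" "card G > S"
  using assms by (metis card.infinite infinite_arbitrarily_large lessI not_less0 order_refl)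

text \<open>Only finitely many elements matter: a finite subcollection is determined by its traces
  on a finite set, which can be relabelled by natural numbers. Hence the minimum taken over
  \<open>nat\<close> works for every type.\<close>

lemma unavoidable_above_transfer:
  assumes "unavoidable_above TYPE(nat) k l S"
  shows "unavoidable_above TYPE('a) k l S"
  unfolding unavoidable_above_def
proof (intro allI impI)
  fix F :: "'a set set" assume "infinite F \<or> card F > S"
  then obtain G where G: "G \<subseteq> F" "finite G" "card G > S"
    by (rule obtain_finite_subset_card_gt)
  obtain E where E: "finite E" "inj_on (\<lambda>X. X \<inter> E) G"
    using finite_separating_set[OF G(2)] .
  obtain f :: "'a \<Rightarrow> nat" where f: "inj_on f E"
    using finite_imp_inj_to_nat_seg[OF E(1)] by blast
  have "inj_on (\<lambda>X. f ` (X \<inter> E)) G"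
  proof (rule inj_onI)
    fix X Y assume XY: "X \<in> G" "Y \<in> G" "f ` (X \<inter> E) = f ` (Y \<inter> E)"
    then have "X \<inter> E = Y \<inter> E" using f by (simp add: inj_on_image_eq_iff)
    then show "X = Y" using E(2) XY(1,2) by (auto dest: inj_onD)
  qed
  then have "card ((\<lambda>X. f ` (X \<inter> E)) ` G) > S" using G(3) by (simp add: card_image)
  then show "found_in (singleton_mat (k + 1)) F \<or> found_in (cosingleton_mat (l + 1)) F \<or>
    found_in (monotone_mat (min (k + 1) (l + 1))) F"
    using assms found_in_trace[OF _ f, of _ G] found_in_mono[OF _ G(1)]
    unfolding unavoidable_above_def by blast
qed

section \<open>Staircases: 0 on the diagonal, 1 below it, no condition above it\<close>

definition staircase :: "nat \<Rightarrow> 'a set set \<Rightarrow> bool" where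
  "staircase n F \<longleftrightarrow> (\<exists>H e. (\<forall>i\<le>n. H i \<in> F) \<and> (\<forall>j<n. e j \<notin> H j) \<and> (\<forall>i\<le>n. \<forall>j<i. e j \<in> H i))"

lemma staircase_mono: "staircase n F \<Longrightarrow> F \<subseteq> G \<Longrightarrow> staircase n G"
  unfolding staircase_def by blast

lemma staircase_0: "X \<in> F \<Longrightarrow> staircase 0 F"
  unfolding staircase_def by auto

text \<open>\<open>Y\<close> becomes the new first row and \<open>x\<close> the new first column.
  The other entries of the new row lie above the diagonal, so nothing has to be known about
  them.\<close>

lemma staircase_Suc:
  assumes "staircase n {X \<in> F. x \<in> X}" "Y \<in> F" "x \<notin> Y"
  shows "staircase (Suc n) F"
proof -
  obtain H e where H: "\<forall>i\<le>n. H i \<in> {X \<in> F. x \<in> X}" "\<forall>j<n. e j \<notin> H j"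
    "\<forall>i\<le>n. \<forall>j<i. e j \<in> H i"
    using assms(1) unfolding staircase_def by blast
  show ?thesis unfolding staircase_def
    using H assms(2,3)
    by (intro exI[of _ "case_nat Y H"] exI[of _ "case_nat x e"]) (auto split: nat.splits)
qed

text \<open>Induction along Pascal's rule. A separating element \<open>x\<close> splits
  \<open>F\<close> into \<open>F1\<close> and \<open>F0\<close>; it lengthens a staircase of
  \<open>F1\<close>, or one of the complements of \<open>F0\<close>, by one.\<close>

lemma staircase_exists:
  fixes F :: "'a set set"
  assumes "finite F" "card F > (a + b) choose a"
  shows "staircase (Suc a) (uminus ` F) \<or> staircase (Suc b) F"
  using assms
proof (induction "a + b" arbitrary: a b F rule: less_induct)
  case less
  have "(a + b) choose a > 0" by simp
  then have "card F > 1" using less.prems by linarith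
  then obtain X Y where XY: "X \<in> F" "Y \<in> F" "X \<noteq> Y"
    by (metis One_nat_def card_le_Suc0_iff_eq less.prems(1) not_less)
  \<comment> \<open>\<open>A\<close> and \<open>B\<close> are \<open>X\<close> and \<open>Y\<close>
    in one order or the other.\<close>
  obtain x A B where x: "A \<in> F" "B \<in> F" "x \<in> A" "x \<notin> B"
    using XY by (metis subsetI subset_antisym)
  define F1 where "F1 = {X \<in> F. x \<in> X}"
  define F0 where "F0 = {X \<in> F. x \<notin> X}"
  have fin: "finite F1" "finite F0" using less.prems unfolding F1_def F0_def by auto
  have "F = F1 \<union> F0" "F1 \<inter> F0 = {}" unfolding F1_def F0_def by auto
  then have card: "card F = card F1 + card F0" using fin by (metis card_Un_disjoint)
  have sub: "F1 \<subseteq> F" "F0 \<subseteq> F" unfolding F1_def F0_def by auto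
  have step1: "staircase (Suc n) F" if "staircase n F1" for n
    using that x unfolding F1_def by (intro staircase_Suc)
  \<comment> \<open>Among the complements, those containing \<open>x\<close> come from
    \<open>F0\<close>, and the complement of \<open>A\<close> is the set avoiding
    \<open>x\<close>.\<close>
  have "{X \<in> uminus ` F. x \<in> X} = uminus ` F0" unfolding F0_def by auto
  then have step0: "staircase (Suc n) (uminus ` F)" if "staircase n (uminus ` F0)" for n
    using that x by (intro staircase_Suc[where Y = "- A"]) auto
  show ?case
  proof (cases "a = 0 \<or> b = 0")
    case True
    \<comment> \<open>Both parts are nonempty, so one split already gives a staircase of length 1 on
      either side.\<close>
    have "staircase 0 F1" "staircase 0 (uminus ` F0)"
      using x unfolding F1_def F0_def by (auto intro: staircase_0)
    then show ?thesis using True step0 step1 by auto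
  next
    case False
    then obtain a' b' where ab: "a = Suc a'" "b = Suc b'" by (auto simp: not0_implies_Suc gr0_conv_Suc)
    have "(a + b) choose a = ((a' + b) choose a') + ((a + b') choose a)" unfolding ab by simp
    then consider "card F0 > (a' + b) choose a'" | "card F1 > (a + b') choose a"
      using less.prems(2) card by linarith
    then show ?thesis
    proof cases
      case 1
      \<comment> \<open>The first alternative is lengthened by \<open>x\<close>; the second already
        has the required length and only passes from \<open>F0\<close> to \<open>F\<close>.\<close>
      have "staircase (Suc a') (uminus ` F0) \<or> staircase (Suc b) F0"
        by (rule less.hyps) (use 1 fin ab in auto)
      then show ?thesis using step0 staircase_mono[OF _ sub(2)] ab by blast
    next
      case 2
      have "staircase (Suc a) (uminus ` F1) \<or> staircase (Suc b') F1"
        by (rule less.hyps) (use 2 fin ab in auto)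
      then show ?thesis using step1 staircase_mono[OF _ image_mono[OF sub(1)]] ab by blast
    qed
  qed
qed

section \<open>Ramsey's theorem applied to staircases\<close>

lemma ramsey_num_spec:
  "ramsey_num r > 0 \<and>
    (\<forall>A\<^sub>0 A\<^sub>1. A\<^sub>0 \<union> A\<^sub>1 = nsets {1..ramsey_num r} 2 \<and> A\<^sub>0 \<inter> A\<^sub>1 = {} \<longrightarrow>
      (\<exists>A' \<subseteq> {1..ramsey_num r}. card A' \<ge> r \<and> (nsets A' 2 \<subseteq> A\<^sub>0 \<or> nsets A' 2 \<subseteq> A\<^sub>1)))"
proof -
  let ?P = "\<lambda>n. n > 0 \<and>
    (\<forall>A\<^sub>0 A\<^sub>1. A\<^sub>0 \<union> A\<^sub>1 = nsets {1..n} 2 \<and> A\<^sub>0 \<inter> A\<^sub>1 = {} \<longrightarrow>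
      (\<exists>A' \<subseteq> {1..n}. card A' \<ge> r \<and> (nsets A' 2 \<subseteq> A\<^sub>0 \<or> nsets A' 2 \<subseteq> A\<^sub>1)))"
  \<comment> \<open>Any such \<open>n\<close> shows that the set under \<open>LEAST\<close> is
    nonempty.\<close>
  obtain n where n: "n \<ge> 1" "\<And>(V :: nat set) E. finite V \<Longrightarrow> card V \<ge> n \<Longrightarrow>
      \<exists>R\<subseteq>V. card R = r \<and> clique R E \<or> card R = r \<and> indep R E"
    using ramsey2[of r r] by metis
  have "\<exists>A' \<subseteq> {1..n}. card A' \<ge> r \<and> (nsets A' 2 \<subseteq> A\<^sub>0 \<or> nsets A' 2 \<subseteq> A\<^sub>1)"
    if A: "A\<^sub>0 \<union> A\<^sub>1 = nsets {1..n} 2" for A\<^sub>0 A\<^sub>1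
  proof -
    obtain R where R: "R \<subseteq> {1..n}" "card R = r" "clique R A\<^sub>0 \<or> indep R A\<^sub>0"
      using n(2)[of "{1..n}" A\<^sub>0] by auto
    have "nsets R 2 \<subseteq> A\<^sub>0 \<or> nsets R 2 \<subseteq> - A\<^sub>0"
      using R(3) unfolding clique_def indep_def by (auto elim!: nsets2_E)
    moreover have "nsets R 2 \<subseteq> A\<^sub>0 \<union> A\<^sub>1" unfolding A using R(1) by (rule nsets_mono)
    ultimately have "nsets R 2 \<subseteq> A\<^sub>0 \<or> nsets R 2 \<subseteq> A\<^sub>1" by blast
    with R show ?thesis by blast
  qed
  with n(1) have "?P n" by simp
  then show ?thesis unfolding ramsey_num_def by (rule LeastI)
qed

text \<open>Colour a pair of indices by the staircase entry above the diagonal that it determines.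
  On a homogeneous set these entries are all 1, giving the cosingleton pattern, or all 0, giving the
  monotone one.\<close>

lemma staircase_ramsey:
  assumes "staircase (ramsey_num r) F"
  shows "found_in (cosingleton_mat r) F \<or> found_in (monotone_mat r) F"
proof -
  define n where "n = ramsey_num r"
  obtain H e where H: "\<And>i. i \<le> n \<Longrightarrow> H i \<in> F" and diag: "\<And>j. j < n \<Longrightarrow> e j \<notin> H j"
    and below: "\<And>i j. i \<le> n \<Longrightarrow> j < i \<Longrightarrow> e j \<in> H i"
    using assms unfolding staircase_def n_def by blast
  \<comment> \<open>The smaller index is the row and the larger the column. The shift by 1 matches
    \<open>{1..n}\<close> with indices starting at 0.\<close>
  define A\<^sub>0 where "A\<^sub>0 = {p \<in> nsets {1..n} 2. e (Max p - 1) \<in> H (Min p - 1)}"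
  define A\<^sub>1 where "A\<^sub>1 = {p \<in> nsets {1..n} 2. e (Max p - 1) \<notin> H (Min p - 1)}"
  have "A\<^sub>0 \<union> A\<^sub>1 = nsets {1..n} 2" "A\<^sub>0 \<inter> A\<^sub>1 = {}"
    unfolding A\<^sub>0_def A\<^sub>1_def by auto
  then obtain A' where A': "A' \<subseteq> {1..n}" "card A' \<ge> r" "nsets A' 2 \<subseteq> A\<^sub>0 \<or> nsets A' 2 \<subseteq> A\<^sub>1"
    using ramsey_num_spec[of r] unfolding n_def by blast
  obtain A where A: "A \<subseteq> A'" "card A = r" "finite A"
    using A'(2) obtain_subset_with_card_n by metis
  obtain g where bij: "bij_betw g {..<r} A" and mono: "strict_mono_on {..<r} g"
    using ex_bij_betw_strict_mono_card[of A] A(2,3) by metis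
  have g: "g i \<in> A" if "i < r" for i
    using bij that by (auto simp: bij_betw_def)
  have g_less: "g i < g j" if "i < j" "j < r" for i j
    using mono that by (simp add: strict_mono_on_def)
  have g_range: "1 \<le> g i \<and> g i \<le> n" if "i < r" for i
    using g[OF that] A(1) A'(1) by auto
  have pair: "{g i, g j} \<in> nsets A' 2 \<and> Max {g i, g j} = g j \<and> Min {g i, g j} = g i"
    if "i < j" "j < r" for i j
    using g_less[OF that] g[of i] g[of j] that A(1) by (auto simp: nsets_def)
  \<comment> \<open>Ramsey's theorem selects \<open>r\<close> rows and columns. The missing row
    \<open>r\<close> is the last row \<open>H n\<close>, which contains every \<open>e j\<close>
    with \<open>j < n\<close>.\<close>
  define K where "K i = (if i < r then H (g i - 1) else H n)" for i
  define d where "d j = e (g j - 1)" for j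
  have K: "K i \<in> F" for i
    unfolding K_def using g_range[of i] by (auto intro!: H)
  have d_below: "d j \<in> K i" if "j < i" "i \<le> r" for i j
  proof (cases "i < r")
    case True
    \<comment> \<open>Since \<open>g j\<close> is at least 1, the truncated subtraction keeps the
      inequality strict.\<close>
    then have "g j - 1 < g i - 1" "g i - 1 \<le> n"
      using g_less[OF that(1)] g_range[of i] g_range[of j] that(1) by auto
    then show ?thesis unfolding K_def d_def using True below by simp
  next
    case False
    then show ?thesis
      unfolding K_def d_def using that g_range[of j] by (auto intro!: below)
  qed
  have d_diag: "d j \<notin> K j" if "j < r" for j
    unfolding K_def d_def using that g_range[OF that] by (auto intro!: diag)
  from A'(3) show ?thesis
  proof
    assume "nsets A' 2 \<subseteq> A\<^sub>0"
    have "d j \<in> K i" if "i < j" "j < r" for i j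
    proof -
      have "{g i, g j} \<in> A\<^sub>0" using pair[OF that] \<open>nsets A' 2 \<subseteq> A\<^sub>0\<close> by blast
      then have "e (g j - 1) \<in> H (g i - 1)"
        unfolding A\<^sub>0_def mem_Collect_eq using pair[OF that] by metis
      then show ?thesis unfolding K_def d_def using that by simp
    qed
    then have "incidence r (\<lambda>i j. i \<noteq> j) F"
      using K d_below d_diag
      by (intro incidenceI[where H = K and e = d]) (metis linorder_neqE_nat)+
    then show ?thesis by (simp add: found_in_cosingleton_iff)
  next
    assume "nsets A' 2 \<subseteq> A\<^sub>1"
    have "d j \<notin> K i" if "i < j" "j < r" for i j
    proof -
      have "{g i, g j} \<in> A\<^sub>1" using pair[OF that] \<open>nsets A' 2 \<subseteq> A\<^sub>1\<close> by blast
      then have "e (g j - 1) \<notin> H (g i - 1)"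
        unfolding A\<^sub>1_def mem_Collect_eq using pair[OF that] by metis
      then show ?thesis unfolding K_def d_def using that by simp
    qed
    then have "incidence r (\<lambda>i j. i \<ge> j + 1) F"
      using K d_below d_diag
      by (intro incidenceI[where H = K and e = d]) (metis Suc_eq_plus1 Suc_le_eq linorder_neqE_nat)+
    then show ?thesis by (simp add: found_in_monotone_iff)
  qed
qed

section \<open>The binomial bound and the theorem\<close>

lemma unavoidable_above_binomial:
  "unavoidable_above TYPE('a) k l
     ((ramsey_num (k + 1) + ramsey_num (l + 1) - 2) choose (ramsey_num (k + 1) - 1))"
  unfolding unavoidable_above_def
proof (intro allI impI)
  fix F :: "'a set set"
  \<comment> \<open>Ramsey numbers are positive, so their predecessors can serve as the parameters
    of \<open>staircase_exists\<close>.\<close>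
  obtain a b where ab: "ramsey_num (k + 1) = Suc a" "ramsey_num (l + 1) = Suc b"
    using ramsey_num_spec by (metis gr0_implies_Suc)
  assume "infinite F \<or>
    card F > (ramsey_num (k + 1) + ramsey_num (l + 1) - 2) choose (ramsey_num (k + 1) - 1)"
  then obtain G where G: "G \<subseteq> F" "finite G" "card G > (a + b) choose a"
    unfolding ab by (elim obtain_finite_subset_card_gt) simp
  have "found_in (singleton_mat (k + 1)) G \<or> found_in (cosingleton_mat (l + 1)) G \<or>
    found_in (monotone_mat (min (k + 1) (l + 1))) G"
    using staircase_exists[OF G(2,3)]
  proof
    \<comment> \<open>A long staircase among the complements gives a cosingleton matrix there, hence
      a singleton matrix in \<open>G\<close>; a monotone matrix stays monotone.\<close>
    assume "staircase (Suc a) (uminus ` G)"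
    then have "found_in (cosingleton_mat (k + 1)) (uminus ` G) \<or>
      found_in (monotone_mat (k + 1)) (uminus ` G)"
      using ab by (intro staircase_ramsey) simp
    then show ?thesis
      using found_in_cosingleton_uminus found_in_monotone_uminus found_in_monotone_le
      by (metis min.cobounded1)
  next
    assume "staircase (Suc b) G"
    then have "found_in (cosingleton_mat (l + 1)) G \<or> found_in (monotone_mat (l + 1)) G"
      using ab by (intro staircase_ramsey) simp
    then show ?thesis
      using found_in_monotone_le by (metis min.cobounded2)
  qed
  then show "found_in (singleton_mat (k + 1)) F \<or> found_in (cosingleton_mat (l + 1)) F \<or>
    found_in (monotone_mat (min (k + 1) (l + 1))) F"
    using found_in_mono[OF _ G(1)] by blast
qed

theorem theorem2:
  fixes k l :: nat
  shows "(\<exists>S. unavoidable_above TYPE('a) k l S) \<and>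
    unavoidable_above TYPE('a) k l (S_num k l) \<and>
    (\<forall>S. unavoidable_above TYPE(nat) k l S \<longrightarrow> S_num k l \<le> S) \<and>
    S_num k l = S_num l k \<and>
    S_num k l \<le> (ramsey_num (k + 1) + ramsey_num (l + 1) - 2) choose (ramsey_num (k + 1) - 1)"
proof (intro conjI)
  show "\<exists>S. unavoidable_above TYPE('a) k l S"
    using unavoidable_above_binomial by blast
  \<comment> \<open>The minimum is attained over \<open>nat\<close>, where the binomial bound is a
    witness, and is then transferred to \<open>'a\<close>.\<close>
  show "unavoidable_above TYPE('a) k l (S_num k l)"
    unfolding S_num_def
    by (rule unavoidable_above_transfer, rule LeastI, rule unavoidable_above_binomial)
  show "\<forall>S. unavoidable_above TYPE(nat) k l S \<longrightarrow> S_num k l \<le> S"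
    unfolding S_num_def by (blast intro: Least_le)
  show "S_num k l = S_num l k"
    proof -
    have "unavoidable_above TYPE(nat) k l = unavoidable_above TYPE(nat) l k"
      using unavoidable_above_commute by blast
    then show ?thesis unfolding S_num_def by simp
  qed
  show "S_num k l \<le> (ramsey_num (k + 1) + ramsey_num (l + 1) - 2) choose (ramsey_num (k + 1) - 1)"
    unfolding S_num_def by (rule Least_le, rule unavoidable_above_binomial)
qed

end
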